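(* We have $$\lim_{x\to\infty}\ \sup_{\substack{A\subset[x,\infty)\\ A\text{ primitive}}} f(A)\ \le\ e^{\gamma}\frac{\pi}{4},$$ where $\gamma$ is the Euler–Mascheroni constant and $f(A)=\sum_{a\in A}\frac{1}{a\log a}$.
   Context: A set $A\subset\mathbb{Z}_{>1}$ is primitive if no member of $A$ divides another member of $A$. The supremum is over primitive sets of integers all of whose elements are at least $x$. *)

theory Defs
  imports "HOL-Analysis.Analysis"
begin

definition primitive :: "nat set \<Rightarrow> bool" where
  "primitive A \<longleftrightarrow> (\<forall>a\<in>A. a > 1) \<and> (\<forall>a\<in>A. \<forall>b\<in>A. a dvd b \<longrightarrow> a = b)"

text \<open>Erdos sum f(A) = sum over a in A of 1/(a log a), as an extended real
  (sum of nonnegative terms = supremum of finite partial sums; may be infinite a priori).\<close>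
definition erdos_sum :: "nat set \<Rightarrow> ereal" where
  "erdos_sum A = (SUP F\<in>{F. finite F \<and> F \<subseteq> A}. ereal (\<Sum>a\<in>F. 1 / (real a * ln (real a))))"

definition sup_primitive :: "real \<Rightarrow> ereal" where
  "sup_primitive x = (SUP A\<in>{A. primitive A \<and> (\<forall>a\<in>A. x \<le> real a)}. erdos_sum A)"

end

theory Submission
  imports Defs "HOL-Number_Theory.Prime_Powers" "HOL-Real_Asymp.Real_Asymp"
begin

text \<open>
  Let \<open>\<Lambda>\<close> be the von Mangoldt function. Send mass along the edges \<open>n \<rightarrow> n * q\<close> of the divisibility
  order so that the edge into \<open>m = n * q\<close> carries the share \<open>\<Lambda> q / ln m\<close> of a weight \<open>flow m\<close> that is slightly
  larger than \<open>1 / (m * ln m)\<close>. Since \<open>\<Lambda>\<close> sums to \<open>ln m\<close> over the divisors of \<open>m\<close>, the inflow at \<open>m\<close>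
  is exactly \<open>flow m\<close>, while by Mertens' estimate the outflow of a large \<open>n\<close> is at most \<open>flow n\<close>.
  Hence no mass is created beyond \<open>X\<close>, and a primitive set \<open>A\<close> in \<open>[X, \<infinity>)\<close> is an antichain
  that every path meets at most once. So the sum of \<open>flow\<close> over \<open>A\<close> is at most the mass that
  crosses from below \<open>X\<close> to above \<open>X\<close>, which again by Mertens is \<open>1 + O(1 / ln X)\<close>. This gives the limit
  bound \<open>1\<close>, which is smaller than \<open>exp \<gamma> * pi / 4\<close>.
\<close>

section \<open>Chebyshev and Mertens estimates for the von Mangoldt function\<close>

lemma ln_fact_eq_sum_mangoldt:
  "ln (fact N) = (\<Sum>d=1..N. mangoldt d * real (N div d))"
proof (induction N)
  case (Suc N)
  have div_Suc: "real (Suc N div d) = real (N div d) + (if d dvd Suc N then 1 else 0)"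
    if "d \<ge> 1" for d
    using that by (auto simp: div_Suc dvd_eq_mod_eq_0)
  have "(\<Sum>d=1..Suc N. mangoldt d * real (Suc N div d)) =
      (\<Sum>d=1..Suc N. mangoldt d * real (N div d) + (if d dvd Suc N then mangoldt d else 0))"
    by (intro sum.cong) (auto simp: div_Suc algebra_simps)
  also have "\<dots> = (\<Sum>d=1..N. mangoldt d * real (N div d)) +
      (\<Sum>d\<in>{1..Suc N}. if d dvd Suc N then mangoldt d else 0)"
    by (simp add: sum.distrib)
  also have "(\<Sum>d\<in>{1..Suc N}. if d dvd Suc N then mangoldt d else 0) =
      (\<Sum>d | d dvd Suc N. mangoldt d :: real)"
    by (rule sum.mono_neutral_cong_right[symmetric, THEN sym])
       (auto dest: dvd_imp_le intro!: Nat.gr0I simp: Suc_le_eq)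
  also have "\<dots> = ln (real (Suc N))"
    by (subst mangoldt_sum) auto
  also have "(\<Sum>d=1..N. mangoldt d * real (N div d)) + ln (real (Suc N)) = ln (fact (Suc N))"
    using Suc by (simp add: ln_mult del: of_nat_Suc)
  finally show ?case by simp
qed simp

text \<open>Chebyshev's argument: in \<open>ln (2 * n choose n)\<close> the coefficient
  \<open>2 * n div d - 2 * (n div d)\<close> of \<open>mangoldt d\<close> is nonnegative, and 1 for
  \<open>n < d \<le> 2 * n\<close>; the binomial coefficient is at most
  \<open>2 ^ (2 * n)\<close>.\<close>

lemma chebyshev_psi_double:
  "(\<Sum>d=1..2*n. mangoldt d) \<le> (\<Sum>d=1..n. mangoldt d) + (2 * real n :: real)"
proof -
  have ext: "(\<Sum>d=1..n. f d) = (\<Sum>d=1..2*n. if d \<le> n then f d else 0)" for f :: "nat \<Rightarrow> real"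
    by (rule sum.mono_neutral_cong_left) auto
  have pt: "(mangoldt d :: real) \<le> (if d \<le> n then mangoldt d else 0) + mangoldt d * real (2 * n div d)
      - 2 * (mangoldt d * real (n div d))" if "d \<in> {1..2*n}" for d
  proof -
    have "d \<le> n \<Longrightarrow> 2 * (n div d) \<le> 2 * n div d"
      using that by (simp add: less_eq_div_iff_mult_less_eq mult.assoc)
    hence "d \<le> n \<Longrightarrow> real (2 * n div d) - 2 * real (n div d) \<ge> 0"
      by (metis diff_ge_0_iff_ge of_nat_le_iff of_nat_mult of_nat_numeral)
    moreover have "d > n \<Longrightarrow> 2 * n div d = 1"
      using that by (intro div_nat_eqI) auto
    ultimately show ?thesis
      using mangoldt_nonneg[of d] mult_nonneg_nonneg[of "mangoldt d" "real (2 * n div d) - 2 * real (n div d)"]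
      by (cases "d \<le> n") (auto simp: algebra_simps)
  qed
  have "(\<Sum>d=1..2*n. mangoldt d) \<le> (\<Sum>d=1..n. mangoldt d) + ln (fact (2*n)) - 2 * ln (fact n :: real)"
  proof -
    have "(\<Sum>d=1..n. mangoldt d * real (n div d)) = (\<Sum>d=1..2*n. mangoldt d * real (n div d) :: real)"
      by (rule sum.mono_neutral_left) auto
    thus ?thesis
      unfolding ln_fact_eq_sum_mangoldt ext[of mangoldt]
      using sum_mono[OF pt, of "{1..2*n}" "\<lambda>d. d"]
      by (simp add: sum.distrib sum_subtractf flip: sum_distrib_left)
  qed
  also have "\<dots> = (\<Sum>d=1..n. mangoldt d) + ln (real (2 * n choose n))"
  proof -
    have "fact n * fact (2*n - n) * (2 * n choose n) = (fact (2*n) :: nat)"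
      by (rule binomial_fact_lemma) simp
    hence "fact (2*n) = (fact n * fact n * real (2 * n choose n) :: real)"
      by (metis add_diff_cancel_left' mult_2 of_nat_fact of_nat_mult)
    thus ?thesis
      by (simp add: ln_mult)
  qed
  also have "ln (real (2 * n choose n)) \<le> ln (2 ^ (2 * n))"
  proof -
    have "(2 * n choose n) \<le> (\<Sum>k\<le>2*n. 2 * n choose k)"
      by (rule member_le_sum) auto
    hence "(2 * n choose n) \<le> 2 ^ (2 * n)"
      by (simp add: choose_row_sum)
    hence "real (2 * n choose n) \<le> 2 ^ (2 * n)"
      by (metis of_nat_le_iff of_nat_numeral of_nat_power)
    thus ?thesis by (subst ln_le_cancel_iff) (auto simp: zero_less_binomial)
  qed
  also have "\<dots> \<le> 2 * real n"
    using ln_le_minus_one[of 2] mult_left_mono[of "ln 2" 1 "2 * real n"] by (simp add: ln_realpow)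
  finally show ?thesis by simp
qed

lemma chebyshev_psi_le: "(\<Sum>d=1..N. mangoldt d) \<le> 4 * real N"
proof (induction N rule: less_induct)
  case (less N)
  show ?case
  proof (cases "N = 0")
    case False
    define n where "n = N div 2"
    have IH: "(\<Sum>d=1..n. mangoldt d) \<le> 4 * real n"
      using False by (intro less) (auto simp: n_def)
    show ?thesis
    proof (cases "even N")
      case True
      hence "N = 2 * n" by (simp add: n_def)
      thus ?thesis using chebyshev_psi_double[of n] IH by simp
    next
      case odd: False
      hence N: "N = Suc (2 * n)" by (simp add: n_def)
      \<comment> \<open>The even part costs only \<open>6 * n\<close> of the more than
        \<open>8 * n\<close> allowed, which leaves \<open>2 * n\<close> for the extra odd
        term.\<close>
      have "mangoldt N \<le> ln (real N)"
        using False by (intro mangoldt_le) auto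
      also have "\<dots> \<le> 2 * real n"
        using ln_le_minus_one[of "real N"] N by simp
      finally show ?thesis
        using chebyshev_psi_double[of n] IH unfolding N by simp
    qed
  qed simp
qed

lemma ln_fact_le: "ln (fact n) \<le> real n * ln (real n)"
proof (cases "n = 0")
  case False
  have "(fact n :: real) \<le> real n ^ n"
    by (metis fact_le_power of_nat_fact of_nat_le_iff of_nat_power order_refl)
  hence "ln (fact n :: real) \<le> ln (real n ^ n)"
    using False by (subst ln_le_cancel_iff) auto
  thus ?thesis using False by (simp add: ln_realpow)
qed simp

lemma ln_fact_ge: "ln (fact n) \<ge> real n * ln (real n) - real n"
proof (induction n)
  case (Suc n)
  have "real n * (ln (real (Suc n)) - ln (real n)) \<le> 1"
  proof (cases "n = 0")
    case False
    hence "ln (real (Suc n)) - ln (real n) \<le> (real (Suc n) - real n) / real n"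
      by (intro ln_diff_le) auto
    thus ?thesis using False by (simp add: field_simps)
  qed simp
  thus ?case using Suc by (simp add: ln_mult algebra_simps del: of_nat_Suc) (simp add: algebra_simps)
qed simp

text \<open>Replacing \<open>N / d\<close> by \<open>N div d\<close> costs at most
  \<open>mangoldt d\<close> per term, hence \<open>4 * N\<close> in total by Chebyshev; the rest is
  \<open>ln (fact N)\<close>.\<close>

lemma mertens_mangoldt_upper:
  assumes "N \<ge> 1"
  shows "(\<Sum>d=1..N. mangoldt d / real d) \<le> ln (real N) + 4"
proof -
  have "real N * (\<Sum>d=1..N. mangoldt d / real d) \<le> (\<Sum>d=1..N. mangoldt d * real (N div d) + mangoldt d)"
    unfolding sum_distrib_left
  proof (rule sum_mono)
    fix d assume d: "d \<in> {1..N}"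
    have "N = N div d * d + N mod d" by simp
    hence "real N = real (N div d) * real d + real (N mod d)"
      by (metis of_nat_add of_nat_mult)
    also have "real (N mod d) \<le> real d" using d by (auto intro: less_imp_le)
    finally have "real N / real d \<le> real (N div d) + 1"
      using d by (simp add: field_simps)
    from mult_left_mono[OF this mangoldt_nonneg[of d]]
    show "real N * (mangoldt d / real d) \<le> mangoldt d * real (N div d) + mangoldt d"
      by (simp add: algebra_simps)
  qed
  also have "\<dots> = ln (fact N) + (\<Sum>d=1..N. mangoldt d)"
    by (simp add: sum.distrib ln_fact_eq_sum_mangoldt)
  also have "\<dots> \<le> real N * (ln (real N) + 4)"
    using ln_fact_le[of N] chebyshev_psi_le[of N] by (simp add: algebra_simps)
  finally show ?thesis using assms by simp
qed

lemma mertens_mangoldt_lower: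
  assumes "N \<ge> 1"
  shows "(\<Sum>d=1..N. mangoldt d / real d) \<ge> ln (real N) - 1"
proof -
  have "real N * (ln (real N) - 1) \<le> (\<Sum>d=1..N. mangoldt d * real (N div d))"
    using ln_fact_ge[of N] by (simp add: ln_fact_eq_sum_mangoldt algebra_simps)
  also have "\<dots> \<le> real N * (\<Sum>d=1..N. mangoldt d / real d)"
    unfolding sum_distrib_left
  proof (rule sum_mono)
    fix d assume d: "d \<in> {1..N}"
    have "real (N div d) * real d \<le> real N"
      by (metis div_times_less_eq_dividend of_nat_le_iff of_nat_mult)
    hence "real (N div d) \<le> real N / real d"
      using d by (simp add: field_simps)
    from mult_left_mono[OF this mangoldt_nonneg[of d]]
    show "mangoldt d * real (N div d) \<le> real N * (mangoldt d / real d)"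
      by (simp add: mult.commute)
  qed
  finally show ?thesis using assms by simp
qed

text \<open>The 6 collects 4 from the upper bound at \<open>t\<close>, 1 from the lower bound at
  \<open>p\<close>, and 1 for the term \<open>q = p\<close> itself.\<close>

lemma mertens_mangoldt_interval:
  assumes "1 \<le> p" "p \<le> t"
  shows "(\<Sum>q=p..t. mangoldt q / real q) \<le> ln (real t) - ln (real p) + 6"
proof -
  have "(\<Sum>q=1..t. mangoldt q / real q) =
      (\<Sum>q=1..p. mangoldt q / real q) + (\<Sum>q=Suc p..t. mangoldt q / real q :: real)"
    using sum.ub_add_nat[of 1 p "\<lambda>q. mangoldt q / real q" "t - p"] assms by simp
  moreover have "(\<Sum>q=p..t. mangoldt q / real q) =
      mangoldt p / real p + (\<Sum>q=Suc p..t. mangoldt q / real q :: real)"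
    using assms by (simp add: sum.atLeast_Suc_atMost)
  moreover have "mangoldt p / real p \<le> (1::real)"
    using mangoldt_le[of p] ln_le_minus_one[of "real p"] assms by (simp add: field_simps)
  ultimately show ?thesis
    using mertens_mangoldt_upper[of t] mertens_mangoldt_lower[of p] assms by linarith
qed

section \<open>Partial summation\<close>

text \<open>Induction on \<open>M\<close>: a nonpositive partial sum can only gain when its factor
  drops from \<open>g M\<close> to \<open>g (Suc M)\<close>.\<close>

lemma sum_mult_antimono_le_last:
  fixes d g :: "nat \<Rightarrow> real"
  assumes "\<And>t. p \<le> t \<Longrightarrow> (\<Sum>q=p..t. d q) \<le> 0"
  assumes "\<And>s t. p \<le> s \<Longrightarrow> s \<le> t \<Longrightarrow> g t \<le> g s"
  assumes "p \<le> M"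
  shows "(\<Sum>q=p..M. d q * g q) \<le> g M * (\<Sum>q=p..M. d q)"
  using \<open>p \<le> M\<close>
proof (induction M rule: dec_induct)
  case (step M)
  have "g M * (\<Sum>q=p..M. d q) \<le> g (Suc M) * (\<Sum>q=p..M. d q)"
    using step assms by (intro mult_right_mono_neg) auto
  thus ?case using step by (simp add: algebra_simps)
qed simp

text \<open>Mertens controls \<open>mangoldt q / q\<close> only in partial sums, not termwise; this
  carries such control over to decreasing weights.\<close>

lemma sum_mult_antimono_le:
  fixes a b g :: "nat \<Rightarrow> real"
  assumes "\<And>t. p \<le> t \<Longrightarrow> (\<Sum>q=p..t. a q) \<le> (\<Sum>q=p..t. b q)"
  assumes "\<And>s t. p \<le> s \<Longrightarrow> s \<le> t \<Longrightarrow> g t \<le> g s"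
  assumes "\<And>t. p \<le> t \<Longrightarrow> 0 \<le> g t"
  assumes "p \<le> M"
  shows "(\<Sum>q=p..M. a q * g q) \<le> (\<Sum>q=p..M. b q * g q)"
proof -
  have "(\<Sum>q=p..M. (a q - b q) * g q) \<le> g M * (\<Sum>q=p..M. a q - b q)"
    using assms by (intro sum_mult_antimono_le_last) (auto simp: sum_subtractf)
  also have "\<dots> \<le> 0"
    using assms by (intro mult_nonneg_nonpos) (auto simp: sum_subtractf)
  finally show ?thesis by (simp add: left_diff_distrib sum_subtractf)
qed


section \<open>Weights in the logarithmic variable\<close>

text \<open>
  In the variable \<open>u = ln m\<close>, an edge into \<open>m = n * q\<close> carries \<open>\<Lambda> q * density u / m\<close>, and \<open>- potential' = density\<close>.
  The second-order term absorbs the error in \<open>mertens_mangoldt_interval\<close>: any constant exceeding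
  twice the \<open>6\<close> there would do instead of \<open>24\<close>, with another threshold in \<open>flow_outflow_le\<close>.
\<close>

definition density :: "real \<Rightarrow> real" where
  "density u = 1 / u ^ 2 + 24 / u ^ 3"

definition potential :: "real \<Rightarrow> real" where
  "potential u = 1 / u + 12 / u ^ 2"

lemma density_pos: "u > 0 \<Longrightarrow> density u > 0"
  unfolding density_def by (intro add_pos_pos divide_pos_pos) auto

lemma potential_pos: "u > 0 \<Longrightarrow> potential u > 0"
  unfolding potential_def by (intro add_pos_pos divide_pos_pos) auto

lemma density_antimono: "0 < u \<Longrightarrow> u \<le> v \<Longrightarrow> density v \<le> density u"
  unfolding density_def by (intro add_mono divide_left_mono power_mono mult_pos_pos) auto

lemma potential_antimono: "0 < u \<Longrightarrow> u \<le> v \<Longrightarrow> potential v \<le> potential u"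
  unfolding potential_def by (intro add_mono divide_left_mono power_mono mult_pos_pos) auto

text \<open>Right-endpoint bound for the integral of the decreasing function \<open>density\<close>
  over \<open>[u, v]\<close>, checked algebraically for each of its two terms.\<close>

lemma density_le_potential_diff:
  assumes "0 < u" "u \<le> v"
  shows "(v - u) * density v \<le> potential u - potential v"
proof -
  have v: "v > 0" using assms by simp
  have "(v - u) / v ^ 2 \<le> (v - u) / (u * v)"
    using assms v by (intro divide_left_mono) (auto simp: power2_eq_square intro: mult_right_mono)
  also have "\<dots> = 1 / u - 1 / v"
    using assms v by (simp add: field_simps)
  finally have 1: "(v - u) / v ^ 2 \<le> 1 / u - 1 / v" .
  have le: "2 * (u ^ 2 * v ^ 2) \<le> (u + v) * v ^ 3"
  proof -
    have "u * u \<le> v * v" "u * v \<le> v * v" "u * u \<le> u * v"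
      using assms v by (auto intro!: mult_mono)
    hence "2 * u ^ 2 \<le> (u + v) * v"
      by (simp add: algebra_simps power2_eq_square)
    hence "2 * u ^ 2 * v ^ 2 \<le> (u + v) * v * v ^ 2"
      by (intro mult_right_mono) auto
    thus ?thesis by (simp add: power2_eq_square power3_eq_cube mult_ac)
  qed
  have "(v - u) * (24 / v ^ 3) = (v - u) * (12 * (2 * (u ^ 2 * v ^ 2))) / (u ^ 2 * v ^ 2 * v ^ 3)"
    using assms v by (simp add: field_simps)
  also have "\<dots> \<le> (v - u) * (12 * ((u + v) * v ^ 3)) / (u ^ 2 * v ^ 2 * v ^ 3)"
    using assms v le by (intro divide_right_mono mult_left_mono) auto
  also have "\<dots> = 12 / u ^ 2 - 12 / v ^ 2"
    using assms v by (simp add: divide_simps) (simp add: power2_eq_square power3_eq_cube algebra_simps)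
  finally have 2: "(v - u) * (24 / v ^ 3) \<le> 12 / u ^ 2 - 12 / v ^ 2" .
  show ?thesis
    using 1 2 by (simp add: density_def potential_def distrib_left)
qed

lemma mangoldt_density_tail:
  assumes "n \<ge> 1" "p \<ge> 1" "n * p \<ge> 2"
  shows "(\<Sum>q=p..M. mangoldt q / real q * density (ln (real (n * q)))) \<le>
           potential (ln (real (n * p))) + 6 * density (ln (real (n * p)))"
proof -
  have ln_pos: "ln (real (n * q)) > 0" if "q \<ge> p" for q
  proof -
    have "2 \<le> n * q" using assms that by (meson le_trans mult_le_mono2)
    thus ?thesis by (intro ln_gt_zero) linarith
  qed
  have ln_mono: "ln (real (n * s)) \<le> ln (real (n * t))" if "p \<le> s" "s \<le> t" for s t
    using that assms by (subst ln_le_cancel_iff) auto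
  show ?thesis
  proof (cases "p \<le> M")
    case True
    \<comment> \<open>The partial sums of \<open>b\<close> equal the bound of
      \<open>mertens_mangoldt_interval\<close>: its 6 sits at \<open>q = p\<close>, and the later
      increments of \<open>ln q\<close> let \<open>potential\<close> bound the weighted sum by
      telescoping.\<close>
    define b where "b q = (if q = p then 6 else ln (real q) - ln (real (q - 1)))" for q
    have sum_b: "(\<Sum>q=p..t. b q) = ln (real t) - ln (real p) + 6" if "p \<le> t" for t
      using that by (induction t rule: dec_induct) (auto simp: b_def)
    have "(\<Sum>q=p..M. mangoldt q / real q * density (ln (real (n * q)))) \<le>
        (\<Sum>q=p..M. b q * density (ln (real (n * q))))"
      using True assms mertens_mangoldt_interval ln_pos ln_mono
      by (intro sum_mult_antimono_le) (auto simp del: of_nat_mult simp: sum_b intro!: density_antimono less_imp_le[OF density_pos])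
    also have "\<dots> \<le> 6 * density (ln (real (n * p))) + (potential (ln (real (n * p))) - potential (ln (real (n * M))))"
      using True
    proof (induction M rule: dec_induct)
      case (step k)
      have "b (Suc k) = ln (real (n * Suc k)) - ln (real (n * k))"
        using step assms by (simp add: b_def ln_mult del: of_nat_Suc mult_Suc_right)
      moreover have "(ln (real (n * Suc k)) - ln (real (n * k))) * density (ln (real (n * Suc k)))
          \<le> potential (ln (real (n * k))) - potential (ln (real (n * Suc k)))"
        using step by (intro density_le_potential_diff ln_pos ln_mono) auto
      ultimately show ?case
        using step by (simp del: of_nat_mult mult_Suc_right)
    qed (simp add: b_def)
    also have "\<dots> \<le> potential (ln (real (n * p))) + 6 * density (ln (real (n * p)))"
      using potential_pos[OF ln_pos[OF True]] by simp
    finally show ?thesis .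
  next
    case False
    thus ?thesis
      using potential_pos[OF ln_pos[of p]] density_pos[OF ln_pos[of p]] by simp
  qed
qed

section \<open>Balance of the flow at a vertex\<close>

text \<open>With \<open>u = ln m\<close> this is \<open>(1 / u + 24 / u ^ 2) / m\<close>: the Erdos
  weight plus a second-order reserve that pays for the error in Mertens' estimate.\<close>

definition flow :: "nat \<Rightarrow> real" where
  "flow m = ln (real m) * density (ln (real m)) / real m"

lemma flow_nonneg: "flow m \<ge> 0"
proof (cases "m \<le> 1")
  case False
  hence "ln (real m) > 0" by simp
  thus ?thesis unfolding flow_def
    by (intro divide_nonneg_nonneg mult_nonneg_nonneg less_imp_le[OF density_pos]) auto
qed (auto simp: flow_def le_Suc_eq)

lemma flow_ge: "m > 1 \<Longrightarrow> 1 / (real m * ln (real m)) \<le> flow m"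
  unfolding flow_def density_def by (simp add: field_simps power2_eq_square power3_eq_cube)

lemma flow_inflow:
  assumes "m > 1"
  shows "flow m = (\<Sum>q | q dvd m \<and> q \<noteq> 1. mangoldt q * density (ln (real m)) / real m)"
proof -
  have "(\<Sum>q | q dvd m \<and> q \<noteq> 1. mangoldt q * density (ln (real m)) / real m) =
      (\<Sum>q | q dvd m. mangoldt q * density (ln (real m)) / real m)"
    using assms by (intro sum.mono_neutral_left) auto
  also have "\<dots> = (\<Sum>q | q dvd m. mangoldt q) * density (ln (real m)) / real m"
    by (simp add: sum_distrib_right sum_divide_distrib)
  finally have "(\<Sum>q | q dvd m \<and> q \<noteq> 1. mangoldt q * density (ln (real m)) / real m) = \<dots>" .
  thus ?thesis using assms by (simp add: mangoldt_sum flow_def)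
qed

lemma flow_outflow_le:
  assumes "ln (real n) \<ge> 24"
  shows "(\<Sum>q=1..M. mangoldt q * density (ln (real (n * q))) / real (n * q)) \<le> flow n"
proof -
  define L where "L = ln (real n)"
  have L: "L \<ge> 24" using assms by (simp add: L_def)
  have n: "n \<ge> 2" using assms by (cases "n \<le> 1") (auto simp: le_Suc_eq)
  have "(\<Sum>q=1..M. mangoldt q * density (ln (real (n * q))) / real (n * q)) =
      (\<Sum>q=1..M. mangoldt q / real q * density (ln (real (n * q)))) / real n"
    by (simp add: sum_divide_distrib mult.commute mult.left_commute)
  also have "\<dots> \<le> (potential L + 6 * density L) / real n"
    using mangoldt_density_tail[of n 1 M] n by (intro divide_right_mono) (auto simp: L_def)
  also have "potential L + 6 * density L \<le> L * density L"
  proof -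
    \<comment> \<open>Of the reserve \<open>24 / L ^ 2\<close>, \<open>potential\<close> takes 12
      parts and \<open>6 * density\<close> takes 6. The remaining \<open>6 / L ^ 2\<close> must
      cover \<open>144 / L ^ 3\<close>, whence the threshold \<open>L \<ge> 24\<close>.\<close>
    have "144 / L ^ 3 \<le> 6 / L ^ 2"
      using L by (simp add: divide_simps power2_eq_square power3_eq_cube)
    moreover have "L * density L = 1 / L + 24 / L ^ 2"
      using L by (simp add: density_def field_simps power2_eq_square power3_eq_cube)
    ultimately show ?thesis by (simp add: potential_def density_def)
  qed
  finally show ?thesis by (simp add: flow_def L_def divide_right_mono)
qed

section \<open>Primitive sets and the cut at \<open>X\<close>\<close>

lemma sum_inverse_le_ln:
  assumes "X \<ge> 1"
  shows "(\<Sum>n=1..<X. 1 / real n) \<le> 1 + ln (real X)"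
proof -
  have "(\<Sum>n=1..<X. 1 / real n) \<le> (\<Sum>n=1..X. 1 / real n)"
    by (rule sum_mono2) auto
  also have "\<dots> = harm X" by (simp add: harm_def inverse_eq_divide)
  also have "\<dots> \<le> 1 + ln (real X)"
    using euler_mascheroni_sequence_decreasing[of 1 X] assms by (simp add: harm_def)
  finally show ?thesis .
qed

lemma primitive_flow_le:
  assumes A: "primitive A" "finite A" and X: "\<And>a. a \<in> A \<Longrightarrow> X \<le> a" "ln (real X) \<ge> 24"
  shows "(\<Sum>a\<in>A. flow a) \<le> (1 + ln (real X)) * (potential (ln (real X)) + 6 * density (ln (real X)))"
proof -
  define N where "N = Max (insert X A)"
  have N: "a \<le> N" if "a \<in> A" for a
    using A that by (auto simp: N_def)
  have X2: "X \<ge> 2" using X(2) by (cases "X \<le> 1") (auto simp: le_Suc_eq)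
  \<comment> \<open>\<open>C\<close> collects the points not yet separated from the source by \<open>A\<close>. By primitivity every edge
    into \<open>A \<union> C\<close> starts below \<open>X\<close> or in \<open>C\<close>; trivial edges \<open>q = 1\<close> carry nothing and must be left out
    for this.\<close>
  define C where "C = {m \<in> {X..N}. \<forall>a\<in>A. \<not> a dvd m}"
  define B where "B = A \<union> C"
  define F where "F = (\<lambda>(n, q). mangoldt q * density (ln (real (n * q))) / real (n * q))"
  define S where "S = {(n, q). n * q \<in> B \<and> q \<noteq> 1}"
  \<comment> \<open>For \<open>n \<ge> 1\<close> this is the ceiling of \<open>X / n\<close>, the
    least multiplier that carries \<open>n\<close> to \<open>X\<close> or beyond.\<close>
  define p where "p n = (X + n - 1) div n" for n
  have fin: "finite C" "finite B" using A by (auto simp: C_def B_def)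
  have B: "X \<le> m" "m \<le> N" if "m \<in> B" for m
    using that X N by (auto simp: B_def C_def)
  have F_nonneg: "F x \<ge> 0" for x
  proof (cases x)
    case (Pair n q)
    \<comment> \<open>The case \<open>k = 0\<close> rests on the convention
      \<open>ln 0 = 0\<close>.\<close>
    have "ln (real k) \<ge> 0" for k by (cases k) auto
    hence "ln (real (n * q)) \<ge> 0" by blast
    hence "density (ln (real (n * q))) \<ge> 0" by (simp add: density_def)
    thus ?thesis using mangoldt_nonneg[of q] by (simp add: F_def Pair)
  qed
  have p: "p n \<ge> 1" "n * p n \<ge> X" "\<And>q. n * q \<ge> X \<Longrightarrow> p n \<le> q" if "n \<ge> 1" for n
  proof -
    show "p n \<ge> 1" using that X2 by (simp add: p_def Suc_le_eq div_greater_zero_iff)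
    have "X + n - 1 < n * p n + n"
      using dividend_less_times_div[of n "X + n - 1"] that by (simp add: p_def)
    thus "n * p n \<ge> X" by linarith
    fix q assume "n * q \<ge> X"
    hence "X + n - 1 < Suc q * n" using that by (simp add: algebra_simps)
    thus "p n \<le> q" using less_mult_imp_div_less[of "X + n - 1" "Suc q" n] by (simp add: p_def)
  qed
  \<comment> \<open>The flow on \<open>C\<close> is added here and returns below as the bound on the
    outflow of \<open>C\<close>, so it cancels at the end.\<close>
  have "(\<Sum>a\<in>A. flow a) + (\<Sum>n\<in>C. flow n) = (\<Sum>m\<in>B. flow m)"
  proof -
    have "A \<inter> C = {}" by (auto simp: C_def)
    thus ?thesis unfolding B_def using A fin by (simp add: sum.union_disjoint)
  qed
  also have "\<dots> = (\<Sum>m\<in>B. \<Sum>q | q dvd m \<and> q \<noteq> 1. mangoldt q * density (ln (real m)) / real m)"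
  proof (intro sum.cong flow_inflow refl)
    fix m assume "m \<in> B"
    thus "m > 1" using B(1)[of m] X2 by linarith
  qed
  also have "\<dots> = (\<Sum>(m, q)\<in>(SIGMA m:B. {q. q dvd m \<and> q \<noteq> 1}). mangoldt q * density (ln (real m)) / real m)"
  proof (intro sum.Sigma ballI fin)
    fix m assume "m \<in> B"
    hence "m > 0" using B(1)[of m] X2 by linarith
    thus "finite {q. q dvd m \<and> q \<noteq> 1}" by simp
  qed
  also have "\<dots> = sum F S"
  proof -
    have "0 \<notin> B" using B(1)[of 0] X2 by auto
    hence "q \<noteq> 0" if "n * q \<in> B" for n q using that by (cases "q = 0") auto
    thus ?thesis
      by (intro sum.reindex_bij_witness[of _ "\<lambda>(n, q). (n * q, q)" "\<lambda>(m, q). (m div q, q)"])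
         (auto simp: S_def F_def simp del: of_nat_mult split: prod.splits)
  qed
  also have "\<dots> \<le> sum F ((SIGMA n:{1..<X}. {p n..N}) \<union> C \<times> {1..N})"
  proof (rule sum_mono2)
    show "S \<subseteq> (SIGMA n:{1..<X}. {p n..N}) \<union> C \<times> {1..N}"
    proof (rule subrelI, rule UnCI)
      fix n q assume nq: "(n, q) \<in> S" "(n, q) \<notin> C \<times> {1..N}"
      hence m: "n * q \<in> B" "q \<noteq> 1" by (simp_all add: S_def)
      hence pos: "n \<ge> 1" "q \<ge> 1" using B(1)[OF m(1)] X2 by (cases "n = 0"; cases "q = 0"; simp)+
      have "n \<le> n * q" "q \<le> n * q" using pos by auto
      hence le: "n \<le> N" "q \<le> N" using B(2)[OF m(1)] by linarith+
      have "n < X"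
      proof (rule ccontr)
        assume "\<not> n < X"
        hence "n \<notin> C" "n \<in> {X..N}" using nq le pos by auto
        \<comment> \<open>Being a multiple of \<open>a\<close>, \<open>n * q\<close> is not in
          \<open>C\<close>, hence in \<open>A\<close>; primitivity then gives
          \<open>a = n * q\<close>, although \<open>a \<le> n\<close> and
          \<open>q > 1\<close>.\<close>
        then obtain a where a: "a \<in> A" "a dvd n" by (auto simp: C_def)
        hence "n * q \<in> A" using m(1) by (auto simp: B_def C_def)
        hence "a = n * q" using A(1) a by (auto simp: primitive_def)
        hence "n * q \<le> n" using a pos by (intro dvd_imp_le) auto
        thus False using pos m(2) by simp
      qed
      thus "(n, q) \<in> (SIGMA n:{1..<X}. {p n..N})"
        using p(3)[of n q] B(1)[OF m(1)] pos le by auto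
    qed
  qed (use fin F_nonneg in auto)
  also have "\<dots> \<le> sum F (SIGMA n:{1..<X}. {p n..N}) + sum F (C \<times> {1..N})"
    using fin F_nonneg by (subst sum_Un) (auto intro!: sum_nonneg)
  also have "sum F (C \<times> {1..N}) \<le> (\<Sum>n\<in>C. flow n)"
  proof -
    have ln_ge: "ln (real n) \<ge> 24" if "n \<in> C" for n
    proof -
      have "ln (real X) \<le> ln (real n)" using that X2 by (subst ln_le_cancel_iff) (auto simp: C_def)
      thus ?thesis using X by simp
    qed
    show ?thesis unfolding F_def sum.cartesian_product[symmetric]
      by (intro sum_mono flow_outflow_le ln_ge)
  qed
  \<comment> \<open>From a source \<open>n < X\<close>, the first edge across the cut ends at
    \<open>n * p n \<ge> X\<close>; since \<open>potential\<close> and \<open>density\<close>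
    decrease, both may be evaluated at \<open>X\<close>.\<close>
  also have "sum F (SIGMA n:{1..<X}. {p n..N}) \<le> 
      (\<Sum>n=1..<X. 1 / real n * (potential (ln (real X)) + 6 * density (ln (real X))))"
  proof -
    have "sum F (SIGMA n:{1..<X}. {p n..N}) = (\<Sum>n=1..<X. \<Sum>q=p n..N. F (n, q))"
      by (subst sum.Sigma) (auto simp: case_prod_eta)
    also have "\<dots> \<le> (\<Sum>n=1..<X. 1 / real n * (potential (ln (real X)) + 6 * density (ln (real X))))"
    proof (rule sum_mono)
      fix n assume n: "n \<in> {1..<X}"
      have lnX: "0 < ln (real X)" using X by simp
      have le: "ln (real X) \<le> ln (real (n * p n))"
        using p(1,2)[of n] n X2 by (subst ln_le_cancel_iff) (auto simp del: of_nat_mult)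
      have "(\<Sum>q=p n..N. F (n, q)) = 1 / real n * (\<Sum>q=p n..N. mangoldt q / real q * density (ln (real (n * q))))"
        by (simp add: F_def sum_distrib_left mult_ac)
      also have "\<dots> \<le> 1 / real n * (potential (ln (real (n * p n))) + 6 * density (ln (real (n * p n))))"
        using p[of n] n X2 by (intro mult_left_mono mangoldt_density_tail) auto
      also have "\<dots> \<le> 1 / real n * (potential (ln (real X)) + 6 * density (ln (real X)))"
        using le lnX by (intro mult_left_mono add_mono potential_antimono density_antimono) auto
      finally show "(\<Sum>q=p n..N. F (n, q)) \<le> 1 / real n * (potential (ln (real X)) + 6 * density (ln (real X)))" .
    qed
    finally show ?thesis .
  qed
  also have "\<dots> = (\<Sum>n=1..<X. 1 / real n) * (potential (ln (real X)) + 6 * density (ln (real X)))"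
    by (simp only: sum_distrib_right)
  also have "\<dots> \<le> (1 + ln (real X)) * (potential (ln (real X)) + 6 * density (ln (real X)))"
    using X X2 potential_pos[of "ln (real X)"] density_pos[of "ln (real X)"]
    by (intro mult_right_mono sum_inverse_le_ln) auto
  finally show ?thesis by simp
qed

section \<open>Passage to the limit\<close>

lemma source_bound_tendsto:
  "((\<lambda>u. (1 + u) * (potential u + 6 * density u)) \<longlongrightarrow> 1) at_top"
  unfolding potential_def density_def by real_asymp

lemma sup_primitive_antimono: "x \<le> y \<Longrightarrow> sup_primitive y \<le> sup_primitive x"
  unfolding sup_primitive_def by (rule SUP_subset_mono) force+

lemma sup_primitive_le:
  assumes c: "c > 1"
  shows "eventually (\<lambda>x. sup_primitive x \<le> ereal c) at_top"
proof -
  \<comment> \<open>The cut is placed at the ceiling of \<open>x\<close>, since an integer that is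
    at least \<open>x\<close> is at least this.\<close>
  have "filterlim (\<lambda>x::real. real (nat \<lceil>x\<rceil>)) at_top at_top"
    by (rule filterlim_at_top_mono[OF filterlim_ident])
       (auto intro!: always_eventually real_nat_ceiling_ge)
  note lim = filterlim_compose[OF ln_at_top this]
  have "eventually (\<lambda>x::real. (1 + ln (real (nat \<lceil>x\<rceil>))) *
      (potential (ln (real (nat \<lceil>x\<rceil>))) + 6 * density (ln (real (nat \<lceil>x\<rceil>)))) < c) at_top"
    by (rule eventually_compose_filterlim[OF order_tendstoD(2)[OF source_bound_tendsto c] lim])
  moreover have "eventually (\<lambda>x::real. ln (real (nat \<lceil>x\<rceil>)) \<ge> 24) at_top"
    using lim by (simp add: filterlim_at_top)
  ultimately show ?thesis
  proof eventually_elim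
    case (elim x)
    show ?case
      unfolding sup_primitive_def erdos_sum_def
    proof (intro SUP_least, clarsimp)
      fix A F :: "nat set"
      assume A: "primitive A" "\<forall>a\<in>A. x \<le> real a" and F: "finite F" "F \<subseteq> A"
      have prim: "primitive F" using A F unfolding primitive_def by blast
      have "(\<Sum>a\<in>F. 1 / (real a * ln (real a))) \<le> (\<Sum>a\<in>F. flow a)"
        using prim by (intro sum_mono flow_ge) (auto simp: primitive_def)
      also have "\<dots> \<le> (1 + ln (real (nat \<lceil>x\<rceil>))) *
          (potential (ln (real (nat \<lceil>x\<rceil>))) + 6 * density (ln (real (nat \<lceil>x\<rceil>))))"
        using A F elim by (intro primitive_flow_le prim) (auto simp: nat_le_iff ceiling_le_iff)
      also have "\<dots> \<le> c" using elim by simp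
      finally show "(\<Sum>a\<in>F. 1 / (real a * ln (real a))) \<le> c" .
    qed
  qed
qed

theorem theorem1p5:
  shows "\<exists>L::ereal. (sup_primitive \<longlongrightarrow> L) at_top \<and>
           L \<le> ereal (exp euler_mascheroni * pi / 4)"
proof (intro exI conjI)
  \<comment> \<open>As \<open>sup_primitive\<close> is antitone, its limit is its infimum.\<close>
  show lim: "(sup_primitive \<longlongrightarrow> (INF x. sup_primitive x)) at_top"
  proof (rule order_tendstoI)
    fix a assume "a < (INF x. sup_primitive x)"
    thus "eventually (\<lambda>x. a < sup_primitive x) at_top"
      by (meson INF_lower UNIV_I always_eventually less_le_trans)
  next
    fix a assume "(INF x. sup_primitive x) < a"
    then obtain x where "sup_primitive x < a" by (auto simp: INF_less_iff)
    thus "eventually (\<lambda>x. sup_primitive x < a) at_top"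
      using sup_primitive_antimono by (intro eventually_at_top_linorderI[of x]) (meson le_less_trans)
  qed
  \<comment> \<open>The linear bound on \<open>exp\<close> is enough against 1, as
    \<open>(52 / 33) * 3 > 4\<close>.\<close>
  have "1 + 19 / 33 \<le> exp (euler_mascheroni :: real)"
    using exp_ge_add_one_self[of "euler_mascheroni :: real"] euler_mascheroni_gt_19_over_33 by linarith
  hence "(1 + 19 / 33) * 3 \<le> exp (euler_mascheroni :: real) * pi"
    using pi_gt3 by (intro mult_mono) auto
  hence "exp euler_mascheroni * pi / 4 > (1 :: real)" by simp
  from sup_primitive_le[OF this]
  show "(INF x. sup_primitive x) \<le> ereal (exp euler_mascheroni * pi / 4)"
    using lim tendsto_upperbound by (metis trivial_limit_at_top_linorder)
qed

end
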